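(* Let problem (P), problems (P)$^\nu$ ($\nu\in\mathbb{N}$), their minimum values $\mathfrak{m}$, $\mathfrak{m}^\nu$, and the value function $V$ be as defined in the context. Assume all of the following. (A1) $X\subset\mathbb{R}^n$, $Y\subset\mathbb{R}^m$, $D\subset\mathbb{R}^q$ are nonempty and closed. (A2) The sets $Y^\nu$, $\nu\in\mathbb{N}$, are nonempty subsets of $Y$ and $Y^\nu\to Y$ in the sense of Painlevé–Kuratowski. (A3) For a sequence $\delta^\nu\to 0$, the functions $g,g^\nu:\mathbb{R}^n\times\mathbb{R}^m\to\mathbb{R}$ satisfy $\sup_{x\in X,y\in Y}|g^\nu(x,y)-g(x,y)|\le\delta^\nu$ for all $\nu\in\mathbb{N}$, and $g$ is continuous relative to $X\times Y$. (A4) For a sequence $\eta^\nu\to 0$, the mappings $H,H^\nu:\mathbb{R}^n\times\mathbb{R}^m\to\mathbb{R}^q$ satisfy $\sup_{x\in X,y\in Y}\big|\operatorname{dist}(H^\nu(x,y),D)-\operatorname{dist}(H(x,y),D)\big|\le\eta^\nu$ for all $\nu\in\mathbb{N}$, and $H$ is continuous relative to $X\times Y$. (A5) For all $x\in X$ and $y\in Y$, the functions $f,f^\nu:\mathbb{R}^n\times\mathbb{R}^m\to(-\infty,\infty]$ satisfy $\limsup_\nu f^\nu(x,y)\le f(x,y)$, and $\liminf_\nu f^\nu(x^\nu,y^\nu)\ge f(x,y)$ whenever $x^\nu\in X\to x$ and $y^\nu\in Y\to y$. (A6) The nonnegative parameters $\sigma^\nu,\theta^\nu,\bar\lambda^\nu$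 satisfy $\bar\lambda^\nu\to\infty$, $\sigma^\nu\eta^\nu\to0$, $\theta^\nu\bar\lambda^\nu\eta^\nu\to0$, and $\theta^\nu\delta^\nu\to0$. Suppose moreover that $\sigma^\nu,\theta^\nu\to\infty$, that $\epsilon^\nu\to0$ (with $\epsilon^\nu\in[0,\infty)$) and $\theta^\nu|\tau^\nu-\tau|\to0$, and that there exists an optimal solution $(x^\star,y^\star)$ of (P) such that $V$ is calm at $x^\star$. For each $\nu\in\mathbb{N}$, let $(x^\nu,y^\nu,u^\nu,\alpha^\nu,\lambda^\nu)$ be an $\epsilon^\nu$-optimal solution of (P)$^\nu$. Suppose there are a subsequence $N\subset\mathbb{N}$ and a point $(\hat x,\hat y,\hat u,\hat\alpha)$ such that $(x^\nu,y^\nu,u^\nu,\alpha^\nu)\to(\hat x,\hat y,\hat u,\hat\alpha)$ along $\nu\in N$, and that $V$ is locally calm at $\hat x$. Then the following hold: (a) If $Y^\nu=Y$ for all $\nu$ sufficiently large, then $(\hat x,\hat y)$ is an optimal solution of (P) and $\mathfrak{m}^\nu\to\mathfrak{m}\in\mathbb{R}$ along $\nu\in N$. (b) If $\theta^\nu\bar\lambda^\nu\sup_{y\in Y}\operatorname{dist}_2(y,Y^\nu)\to0$ and there are constants $\kappa_g,\kappa_H\in[0,\infty)$ such that $$|g(x,y)-g(x,y')|\le\kappa_g\|y-y'\|_2,\qquad \|H(x,y)-H(x,y')\|\le\kappa_H\|y-y'\|_2\qquad\forall x\in X,\ y,y'\in Y,$$ then $(\hat x,\hat y)$ is an optimal solution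 of (P) and $\mathfrak{m}^\nu\to\mathfrak{m}\in\mathbb{R}$ along $\nu\in N$.
   Context: Fix an arbitrary norm $\|\cdot\|$ on $\mathbb{R}^q$; for $a\in\mathbb{R}^q$, $\operatorname{dist}(a,D)=\inf_{a'\in D}\|a-a'\|$. On $\mathbb{R}^m$, $\operatorname{dist}_2(y,C)=\inf_{y'\in C}\|y-y'\|_2$ is the Euclidean point-to-set distance. Infima over the empty set equal $\infty$. Problem (P), with $\tau\in[0,\infty)$: minimize $f(x,y)$ over $x\in X$, $y\in\mathbb{R}^m$ subject to $y\in\tau\text{-}\operatorname{argmin}_{z\in Y}\{g(x,z)\mid H(x,z)\in D\}$; that is, $y\in Y$, $H(x,y)\in D$ and $g(x,y)\le\inf_{z\in Y}\{g(x,z)\mid H(x,z)\in D\}+\tau$. $\mathfrak{m}$ is the infimum of $f(x,y)$ over points satisfying the stated constraints ($\infty$ if there are none). An optimal solution of (P) is a point $(x,y)$ satisfying these constraints with $f(x,y)<\infty$ and $f(x,y)\le\mathfrak{m}$. Problem (P)$^\nu$, with parameters $\sigma^\nu,\theta^\nu,\bar\lambda^\nu,\tau^\nu\in[0,\infty)$: minimize $f^\nu(x,y)+\sigma^\nu\|u\|-\theta^\nu\alpha$ over $(x,y,u,\alpha,\lambda)$ subject to $H^\nu(x,y)+u\in D$; $\;g^\nu(x,y)+\alpha\le g^\nu(x,z)+\lambda\operatorname{dist}(H^\nu(x,z),D)+\tau^\nu$ for all $z\in Y^\nu$; $\;x\in X$, $y\in Y$, $u\in\mathbb{R}^q$, $\alpha\in(-\infty,0]$,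 $\lambda\in[0,\bar\lambda^\nu]$. $\mathfrak{m}^\nu$ is the infimum of its objective function over points satisfying these constraints ($\infty$ if there are none). For $\epsilon\in[0,\infty)$, an $\epsilon$-optimal solution of (P)$^\nu$ is a point satisfying its constraints with objective value finite and at most $\mathfrak{m}^\nu+\epsilon$. Value function: $V(x,u)=\inf_{y\in Y}\{g(x,y)\mid H(x,y)+u\in D\}$ for $x\in\mathbb{R}^n$, $u\in\mathbb{R}^q$. $V$ is calm at $x$ if there is $\lambda\in[0,\infty)$ such that $V(x,u)\ge V(x,0)-\lambda\|u\|$ for all $u\in\mathbb{R}^q$. $V$ is locally calm at $\bar x$ if there are $\lambda\in[0,\infty)$ and $\rho\in(0,\infty)$ such that $V(x,u)\ge V(x,0)-\lambda\|u\|$ for all $u\in\mathbb{R}^q$ and all $x$ with $\|x-\bar x\|_2\le\rho$. $Y^\nu\to Y$ in the sense of Painlevé–Kuratowski means that $Y$ is closed and the distance from $y$ to $Y^\nu$ converges to the distance from $y$ to $Y$ for all $y\in\mathbb{R}^m$. A function $\psi$ is continuous relative to a set $C$ if $\psi(w^\nu)\to\psi(w)$ whenever $w^\nu\in C\to w\in C$. A subsequence $N\subset\mathbb{N}$ is an infinite subset of indices. *)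

theory Defs
  imports "HOL-Analysis.Analysis"
begin

text \<open>An arbitrary norm on a real vector space, which need not be the one of the type class.\<close>

definition is_norm :: "('a::real_vector \<Rightarrow> real) \<Rightarrow> bool" where
  "is_norm N \<longleftrightarrow>
     (\<forall>a. 0 \<le> N a) \<and> (\<forall>a. N a = 0 \<longleftrightarrow> a = 0) \<and>
     (\<forall>c a. N (c *\<^sub>R a) = \<bar>c\<bar> * N a) \<and> (\<forall>a b. N (a + b) \<le> N a + N b)"

text \<open>Point-to-set distance with respect to a given norm. It is extended-real-valued, so that the
  distance to the empty set is infinite (the library's \<^const>\<open>infdist\<close> would give 0).
  The Euclidean distance is the instance \<^term>\<open>set_dist norm\<close>.\<close>

definition set_dist :: "('a::real_vector \<Rightarrow> real) \<Rightarrow> 'a \<Rightarrow> 'a set \<Rightarrow> ereal" where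
  "set_dist N a C = (INF a'\<in>C. ereal (N (a - a')))"

definition pk_converges :: "(nat \<Rightarrow> ('a::real_normed_vector) set) \<Rightarrow> 'a set \<Rightarrow> bool" where
  "pk_converges C\<nu> C \<longleftrightarrow>
     closed C \<and> (\<forall>y. (\<lambda>\<nu>. set_dist norm y (C\<nu> \<nu>)) \<longlonglongrightarrow> set_dist norm y C)"

text \<open>The filter of the indices of \<^term>\<open>S\<close> tending to infinity;
  it is nontrivial exactly when \<^term>\<open>S\<close> is infinite.\<close>

definition along :: "nat set \<Rightarrow> nat filter" where
  "along S = inf sequentially (principal S)"

subsection \<open>Problem (P)\<close>

definition value_fun ::
  "'y set \<Rightarrow> 'u::real_vector set \<Rightarrow> ('x \<Rightarrow> 'y \<Rightarrow> real) \<Rightarrow> ('x \<Rightarrow> 'y \<Rightarrow> 'u) \<Rightarrow> 'x \<Rightarrow> 'u \<Rightarrow> ereal" where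
  "value_fun Y D g H x u = (INF y\<in>{y \<in> Y. H x y + u \<in> D}. ereal (g x y))"

definition tau_argmin ::
  "'y set \<Rightarrow> 'u set \<Rightarrow> ('x \<Rightarrow> 'y \<Rightarrow> real) \<Rightarrow> ('x \<Rightarrow> 'y \<Rightarrow> 'u) \<Rightarrow> real \<Rightarrow> 'x \<Rightarrow> 'y set" where
  "tau_argmin Y D g H \<tau> x =
     {y \<in> Y. H x y \<in> D \<and> ereal (g x y) \<le> (INF z\<in>{z \<in> Y. H x z \<in> D}. ereal (g x z)) + ereal \<tau>}"

definition P_feasible ::
  "'x set \<Rightarrow> 'y set \<Rightarrow> 'u set \<Rightarrow> ('x \<Rightarrow> 'y \<Rightarrow> real) \<Rightarrow> ('x \<Rightarrow> 'y \<Rightarrow> 'u) \<Rightarrow> real \<Rightarrow> ('x \<times> 'y) set" where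
  "P_feasible X Y D g H \<tau> = {(x, y). x \<in> X \<and> y \<in> tau_argmin Y D g H \<tau> x}"

definition P_min ::
  "'x set \<Rightarrow> 'y set \<Rightarrow> 'u set \<Rightarrow> ('x \<Rightarrow> 'y \<Rightarrow> ereal) \<Rightarrow> ('x \<Rightarrow> 'y \<Rightarrow> real) \<Rightarrow> ('x \<Rightarrow> 'y \<Rightarrow> 'u) \<Rightarrow> real \<Rightarrow> ereal"
where
  "P_min X Y D f g H \<tau> = (INF (x, y)\<in>P_feasible X Y D g H \<tau>. f x y)"

definition P_optimal ::
  "'x set \<Rightarrow> 'y set \<Rightarrow> 'u set \<Rightarrow> ('x \<Rightarrow> 'y \<Rightarrow> ereal) \<Rightarrow> ('x \<Rightarrow> 'y \<Rightarrow> real) \<Rightarrow> ('x \<Rightarrow> 'y \<Rightarrow> 'u) \<Rightarrow> real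
    \<Rightarrow> 'x \<Rightarrow> 'y \<Rightarrow> bool" where
  "P_optimal X Y D f g H \<tau> x y \<longleftrightarrow>
     (x, y) \<in> P_feasible X Y D g H \<tau> \<and> f x y < \<infinity> \<and> f x y \<le> P_min X Y D f g H \<tau>"

subsection \<open>The approximating problems, for one index\<close>

text \<open>Below, \<^term>\<open>Y'\<close>, \<^term>\<open>f'\<close>, \<^term>\<open>g'\<close>, \<^term>\<open>H'\<close>, \<^term>\<open>\<tau>'\<close> are the
  data of the approximating problem, \<^term>\<open>N\<close> is the norm on the space of \<^term>\<open>u\<close>, and
  \<^term>\<open>lbar\<close> is the upper bound on \<^term>\<open>lam\<close>. The set \<^term>\<open>Y'\<close> restricts only the
  lower-level variable \<^term>\<open>z\<close>; the variable \<^term>\<open>y\<close> ranges over \<^term>\<open>Y\<close>.\<close>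

definition approx_objective ::
  "('u \<Rightarrow> real) \<Rightarrow> ('x \<Rightarrow> 'y \<Rightarrow> ereal) \<Rightarrow> real \<Rightarrow> real
    \<Rightarrow> 'x \<times> 'y \<times> 'u \<times> real \<times> real \<Rightarrow> ereal" where
  "approx_objective N f' \<sigma> \<theta> = (\<lambda>(x, y, u, \<alpha>, lam). f' x y + ereal (\<sigma> * N u - \<theta> * \<alpha>))"

definition approx_feasible ::
  "('u::real_vector \<Rightarrow> real) \<Rightarrow> 'x set \<Rightarrow> 'y set \<Rightarrow> 'u set \<Rightarrow> 'y set
    \<Rightarrow> ('x \<Rightarrow> 'y \<Rightarrow> real) \<Rightarrow> ('x \<Rightarrow> 'y \<Rightarrow> 'u) \<Rightarrow> real \<Rightarrow> real
    \<Rightarrow> ('x \<times> 'y \<times> 'u \<times> real \<times> real) set" where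
  "approx_feasible N X Y D Y' g' H' lbar \<tau>' =
     {(x, y, u, \<alpha>, lam).
        H' x y + u \<in> D \<and>
        (\<forall>z\<in>Y'. ereal (g' x y + \<alpha>)
                 \<le> ereal (g' x z) + ereal lam * set_dist N (H' x z) D + ereal \<tau>') \<and>
        x \<in> X \<and> y \<in> Y \<and> \<alpha> \<le> 0 \<and> 0 \<le> lam \<and> lam \<le> lbar}"

definition approx_min ::
  "('u::real_vector \<Rightarrow> real) \<Rightarrow> 'x set \<Rightarrow> 'y set \<Rightarrow> 'u set \<Rightarrow> 'y set \<Rightarrow> ('x \<Rightarrow> 'y \<Rightarrow> ereal)
    \<Rightarrow> ('x \<Rightarrow> 'y \<Rightarrow> real) \<Rightarrow> ('x \<Rightarrow> 'y \<Rightarrow> 'u) \<Rightarrow> real \<Rightarrow> real \<Rightarrow> real \<Rightarrow> real \<Rightarrow> ereal" where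
  "approx_min N X Y D Y' f' g' H' \<sigma> \<theta> lbar \<tau>' =
     (INF p\<in>approx_feasible N X Y D Y' g' H' lbar \<tau>'. approx_objective N f' \<sigma> \<theta> p)"

definition approx_eps_optimal ::
  "('u::real_vector \<Rightarrow> real) \<Rightarrow> 'x set \<Rightarrow> 'y set \<Rightarrow> 'u set \<Rightarrow> 'y set \<Rightarrow> ('x \<Rightarrow> 'y \<Rightarrow> ereal)
    \<Rightarrow> ('x \<Rightarrow> 'y \<Rightarrow> real) \<Rightarrow> ('x \<Rightarrow> 'y \<Rightarrow> 'u) \<Rightarrow> real \<Rightarrow> real \<Rightarrow> real \<Rightarrow> real
    \<Rightarrow> real \<Rightarrow> 'x \<times> 'y \<times> 'u \<times> real \<times> real \<Rightarrow> bool" where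
  "approx_eps_optimal N X Y D Y' f' g' H' \<sigma> \<theta> lbar \<tau>' \<epsilon> p \<longleftrightarrow>
     p \<in> approx_feasible N X Y D Y' g' H' lbar \<tau>' \<and>
     \<bar>approx_objective N f' \<sigma> \<theta> p\<bar> \<noteq> \<infinity> \<and>
     approx_objective N f' \<sigma> \<theta> p \<le> approx_min N X Y D Y' f' g' H' \<sigma> \<theta> lbar \<tau>' + ereal \<epsilon>"

subsection \<open>Calmness of a value function\<close>

definition calm_at ::
  "('u::real_vector \<Rightarrow> real) \<Rightarrow> ('x \<Rightarrow> 'u \<Rightarrow> ereal) \<Rightarrow> 'x \<Rightarrow> bool" where
  "calm_at N V x \<longleftrightarrow> (\<exists>lam\<ge>0. \<forall>u. V x u \<ge> V x 0 - ereal (lam * N u))"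

definition locally_calm_at ::
  "('u::real_vector \<Rightarrow> real) \<Rightarrow> ('x::real_normed_vector \<Rightarrow> 'u \<Rightarrow> ereal) \<Rightarrow> 'x \<Rightarrow> bool" where
  "locally_calm_at N V xbar \<longleftrightarrow>
     (\<exists>lam\<ge>0. \<exists>\<rho>>0. \<forall>u x. norm (x - xbar) \<le> \<rho> \<longrightarrow> V x u \<ge> V x 0 - ereal (lam * N u))"

end

theory Submission
  imports Defs
begin

text \<open>Calmness at \<^term>\<open>xstar\<close> makes \<^term>\<open>(xstar, ystar)\<close>, completed by
  \<^term>\<open>lam = lbar\<close>, a near-projection \<^term>\<open>u\<close> and a vanishing \<^term>\<open>\<alpha>\<close>, feasible in
  the approximating problems at asymptotically no extra cost, so their minimum values are
  asymptotically at most the minimum value of (P). Hence the penalty terms of the given solutions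
  stay bounded, and as their weights diverge, \<^term>\<open>u\<close> and \<^term>\<open>\<alpha>\<close> vanish.
  The approximate lower-level inequalities then bound \<open>g(x\<^sup>\<nu>, y\<^sup>\<nu>)\<close> by
  \<open>V(x\<^sup>\<nu>, 0) + \<tau>\<close> up to a vanishing error. The value function need not be upper semicontinuous, but
  local calmness gives \<open>V(x\<^sup>\<nu>, 0) \<le> g(x\<^sup>\<nu>, z) + lam * dist(H(x\<^sup>\<nu>, z), D)\<close> with a
  fixed \<open>lam\<close>, which passes to the limit. So \<^term>\<open>(xhat, yhat)\<close> is feasible, and the lower
  limit condition on the objectives closes the chain of inequalities.\<close>

section \<open>Norms other than that of the type class\<close>

lemma
  assumes "is_norm N"
  shows is_norm_nonneg: "0 \<le> N a"
    and is_norm_zero_iff: "N a = 0 \<longleftrightarrow> a = 0"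
    and is_norm_scaleR: "N (c *\<^sub>R a) = \<bar>c\<bar> * N a"
    and is_norm_triangle: "N (a + b) \<le> N a + N b"
  using assms unfolding is_norm_def by auto

lemma is_norm_minus:
  assumes "is_norm N"
  shows "N (- a) = N a"
  using is_norm_scaleR[OF assms, of "-1" a] by simp

lemma is_norm_minus_commute:
  assumes "is_norm N"
  shows "N (a - b) = N (b - a)"
  using is_norm_minus[OF assms, of "a - b"] by simp

lemma is_norm_convex:
  assumes "is_norm N"
  shows "convex_on UNIV N"
proof (rule convex_onI)
  fix t :: real and x y
  assume "0 < t" "t < 1"
  then show "N ((1 - t) *\<^sub>R x + t *\<^sub>R y) \<le> (1 - t) * N x + t * N y"
    using is_norm_triangle[OF assms, of "(1 - t) *\<^sub>R x" "t *\<^sub>R y"]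
    by (simp add: is_norm_scaleR[OF assms])
qed simp

text \<open>A finite convex function on an open subset of a Euclidean space is continuous, and a
  norm is convex by homogeneity and the triangle inequality.\<close>

lemma is_norm_continuous:
  fixes N :: "'a::euclidean_space \<Rightarrow> real"
  assumes "is_norm N"
  shows "continuous_on UNIV N"
  using convex_on_continuous[OF open_UNIV is_norm_convex[OF assms]] .

text \<open>By compactness \<open>N\<close> attains its minimum over the Euclidean unit sphere; the
  minimum is positive because the minimizer is nonzero, and homogeneity carries the bound to every
  \<open>a\<close>. This is what turns smallness in \<open>N\<close> into Euclidean
  closeness.\<close>

lemma is_norm_dominates_norm:
  fixes N :: "'a::euclidean_space \<Rightarrow> real"
  assumes N: "is_norm N"
  obtains c where "c > 0" "\<And>a. c * norm a \<le> N a"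
proof -
  have ne: "sphere (0::'a) 1 \<noteq> {}" by simp
  obtain p where p: "p \<in> sphere (0::'a) 1" "\<And>q. q \<in> sphere 0 1 \<Longrightarrow> N p \<le> N q"
    using continuous_attains_inf[OF compact_sphere ne
        continuous_on_subset[OF is_norm_continuous[OF N] subset_UNIV]] by blast
  have "p \<noteq> 0" using p(1) by auto
  then have pos: "N p > 0"
    using is_norm_nonneg[OF N, of p] is_norm_zero_iff[OF N, of p] by linarith
  have "N p * norm a \<le> N a" for a
  proof (cases "a = 0")
    case False
    have "N p \<le> N ((1 / norm a) *\<^sub>R a)" using False by (intro p(2)) simp
    also have "\<dots> = N a / norm a" by (simp only: is_norm_scaleR[OF N]) simp
    finally show ?thesis using False by (simp add: field_simps)
  qed (simp add: is_norm_nonneg[OF N])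
  then show ?thesis using that pos by blast
qed

section \<open>Real-valued point-to-set distances\<close>

definition pdist :: "('a::real_vector \<Rightarrow> real) \<Rightarrow> 'a set \<Rightarrow> 'a \<Rightarrow> real" where
  "pdist N D a = (INF a'\<in>D. N (a - a'))"

text \<open>The embedding into \<open>ereal\<close> commutes with infima of nonempty sets bounded
  below. For empty \<open>D\<close> the left side would be infinite and the right side
  finite.\<close>

lemma set_dist_eq_pdist:
  assumes "is_norm N" "D \<noteq> {}"
  shows "set_dist N a D = ereal (pdist N D a)"
proof -
  have "bdd_below ((\<lambda>a'. N (a - a')) ` D)"
    using is_norm_nonneg[OF assms(1)] by (intro bdd_belowI2[where m = 0])
  then show ?thesis
    using ereal_Inf'[of "(\<lambda>a'. N (a - a')) ` D"] assms(2)
    by (simp add: set_dist_def pdist_def image_comp comp_def)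
qed

lemma pdist_le:
  assumes "is_norm N" "a' \<in> D"
  shows "pdist N D a \<le> N (a - a')"
  unfolding pdist_def using assms is_norm_nonneg[OF assms(1)]
  by (intro cINF_lower bdd_belowI2[where m = 0])

lemma pdist_nonneg:
  assumes "is_norm N" "D \<noteq> {}"
  shows "0 \<le> pdist N D a"
  unfolding pdist_def using assms is_norm_nonneg[OF assms(1)] by (intro cINF_greatest)

lemma pdist_eq_0:
  assumes "is_norm N" "a \<in> D"
  shows "pdist N D a = 0"
  using pdist_le[OF assms, of a] pdist_nonneg[OF assms(1), of D a] assms
    is_norm_zero_iff[OF assms(1), of 0] by fastforce

text \<open>The infimum need not be attained, so a projection is replaced by a near-projection with
  slack \<open>s\<close>. It is given as a displacement \<open>u\<close> to match the constraint
  \<open>H x y + u \<in> D\<close>.\<close>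

lemma pdist_approx:
  assumes N: "is_norm N" and "D \<noteq> {}" "0 < s"
  obtains u where "a + u \<in> D" "N u < pdist N D a + s"
proof -
  have "\<exists>y\<in>(\<lambda>a'. N (a - a')) ` D. y < pdist N D a + s"
    using cInf_lessD[of "(\<lambda>a'. N (a - a')) ` D" "pdist N D a + s"] assms
    by (auto simp: pdist_def)
  then obtain a' where "a' \<in> D" "N (a - a') < pdist N D a + s" by auto
  then show ?thesis using that[of "a' - a"] is_norm_minus_commute[OF N, of a a'] by simp
qed

lemma pdist_triangle:
  assumes N: "is_norm N" and D: "D \<noteq> {}"
  shows "pdist N D a \<le> pdist N D b + N (a - b)"
proof (rule field_le_epsilon)
  fix s :: real
  assume "0 < s"
  then obtain u where u: "b + u \<in> D" "N u < pdist N D b + s" using pdist_approx[OF N D] by metis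
  have "pdist N D a \<le> N ((a - b) + (- u))" using pdist_le[OF N u(1), of a] by (simp add: algebra_simps)
  also have "\<dots> \<le> N (a - b) + N u"
    using is_norm_triangle[OF N, of "a - b" "- u"] is_norm_minus[OF N, of u] by simp
  finally show "pdist N D a \<le> pdist N D b + N (a - b) + s" using u(2) by simp
qed

text \<open>Near-projections of \<open>N\<close>-length below \<open>c * e\<close> lie within
  Euclidean distance \<open>e\<close> of \<open>a\<close>, so \<open>a\<close> belongs to the
  closure of \<open>D\<close>.\<close>

lemma pdist_eq_0_imp_mem:
  fixes D :: "'a::euclidean_space set"
  assumes N: "is_norm N" and D: "D \<noteq> {}" "closed D" and 0: "pdist N D a = 0"
  shows "a \<in> D"
proof -
  obtain c where c: "c > 0" "\<And>a. c * norm a \<le> N a"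
    using is_norm_dominates_norm[OF N] by blast
  have "\<exists>y\<in>D. dist y a < e" if "0 < e" for e
  proof -
    have ce: "0 < c * e" using c(1) that by simp
    obtain u where u: "a + u \<in> D" "N u < c * e"
      using pdist_approx[OF N D(1) ce, of a] unfolding 0 by auto
    have "c * norm u < c * e" using c(2)[of u] u(2) by linarith
    then have "norm u < e" using c(1) by simp
    then show ?thesis using u(1) by (intro bexI[of _ "a + u"]) (auto simp: dist_norm)
  qed
  then show ?thesis using D(2) closed_approachable by blast
qed

text \<open>The distance is 1-Lipschitz with respect to \<open>N\<close>, and \<open>N\<close> is
  continuous at 0 in the Euclidean topology.\<close>

lemma pdist_continuous:
  fixes D :: "'a::euclidean_space set"
  assumes N: "is_norm N" and D: "D \<noteq> {}"
  shows "continuous_on UNIV (pdist N D)"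
proof -
  have "(pdist N D \<longlongrightarrow> pdist N D b) (at b)" for b
  proof -
    have N0: "N 0 = 0" using is_norm_zero_iff[OF N] by blast
    have "((\<lambda>a. a - b) \<longlongrightarrow> 0) (at b)" by (rule LIM_zero) simp
    then have "((\<lambda>a. N (a - b)) \<longlongrightarrow> 0) (at b)"
      using continuous_on_tendsto_compose[OF is_norm_continuous[OF N], of "\<lambda>a. a - b" 0 "at b"] N0
      by simp
    moreover have "\<bar>pdist N D a - pdist N D b\<bar> \<le> N (a - b)" for a
      using pdist_triangle[OF N D, of a b] pdist_triangle[OF N D, of b a]
        is_norm_minus_commute[OF N, of a b] by linarith
    ultimately have "((\<lambda>a. pdist N D a - pdist N D b) \<longlongrightarrow> 0) (at b)"
      using Lim_null_comparison[of "\<lambda>a. pdist N D a - pdist N D b" "\<lambda>a. N (a - b)" "at b"] by simp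
    then show ?thesis by (rule LIM_zero_cancel)
  qed
  then show ?thesis by (simp add: continuous_on_eq_continuous_at continuous_at)
qed

text \<open>Calmness of the value function is exactness of the penalty \<open>lam * dist(H(x, \<cdot>), D)\<close>.\<close>

lemma calm_penalty:
  assumes N: "is_norm N" and D: "D \<noteq> {}" and lam: "0 \<le> lam"
    and calm: "\<And>u. value_fun Y D g H x u \<ge> value_fun Y D g H x 0 - ereal (lam * N u)"
    and z: "z \<in> Y"
  shows "value_fun Y D g H x 0 \<le> ereal (g x z + lam * pdist N D (H x z))"
proof (rule ereal_le_epsilon2)
  fix e :: real
  assume e: "0 < e"
  \<comment> \<open>The slack \<open>e / (lam + 1)\<close> is meaningful also for
    \<open>lam = 0\<close> and costs at most \<open>e\<close> once multiplied by
    \<open>lam\<close>.\<close>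
  then obtain u where u: "H x z + u \<in> D" "N u < pdist N D (H x z) + e / (lam + 1)"
    using pdist_approx[OF N D, of "e / (lam + 1)" "H x z"] lam by auto
  have "lam * N u \<le> lam * (pdist N D (H x z) + e / (lam + 1))"
    using u(2) lam by (intro mult_left_mono) auto
  also have "\<dots> \<le> lam * pdist N D (H x z) + e"
    using lam e by (simp add: field_simps)
  finally have le: "lam * N u \<le> lam * pdist N D (H x z) + e" .
  have "value_fun Y D g H x u \<le> ereal (g x z)"
    unfolding value_fun_def using z u(1) by (intro INF_lower) auto
  then have "value_fun Y D g H x 0 - ereal (lam * N u) \<le> ereal (g x z)"
    using calm[of u] by (rule order_trans[rotated])
  then have "value_fun Y D g H x 0 \<le> ereal (g x z + lam * N u)"
    by (cases "value_fun Y D g H x 0") auto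
  also have "\<dots> \<le> ereal (g x z + lam * pdist N D (H x z)) + ereal e"
    using le by simp
  finally show "value_fun Y D g H x 0 \<le> ereal (g x z + lam * pdist N D (H x z)) + ereal e" .
qed

section \<open>Feasible points of the approximating problem for one index\<close>

lemma approx_min_le:
  assumes N: "is_norm N" and D: "D \<noteq> {}"
    and x: "x \<in> X" and y: "y \<in> tau_argmin Y D g H \<tau> x" and Y': "Y' \<subseteq> Y"
    and lam: "0 \<le> lam" "lam \<le> lbar"
    and calm: "\<And>u. value_fun Y D g H x u \<ge> value_fun Y D g H x 0 - ereal (lam * N u)"
    and g': "\<And>z. z \<in> Y \<Longrightarrow> \<bar>g' x z - g x z\<bar> \<le> \<delta>"
    and H': "\<And>z. z \<in> Y \<Longrightarrow> \<bar>pdist N D (H' x z) - pdist N D (H x z)\<bar> \<le> \<eta>"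
    and \<sigma>: "0 \<le> \<sigma>" and s: "0 < s"
  shows "approx_min N X Y D Y' f' g' H' \<sigma> \<theta> lbar \<tau>'
    \<le> f' x y + ereal (\<sigma> * \<eta> + s + \<theta> * (2 * \<delta> + lbar * \<eta> + \<bar>\<tau>' - \<tau>\<bar>))"
proof -
  \<comment> \<open>This \<open>\<alpha>\<close> absorbs all perturbations of the lower-level
    inequality: \<open>g'\<close> for \<open>g\<close> at both \<open>y\<close> and
    \<open>z\<close>, \<open>H'\<close> for \<open>H\<close> in the penalty, and
    \<open>\<tau>'\<close> for \<open>\<tau>\<close>. It adds \<open>- \<theta> * \<alpha>\<close>
    to the objective.\<close>
  define \<alpha> where "\<alpha> = - (2 * \<delta> + lbar * \<eta> + \<bar>\<tau>' - \<tau>\<bar>)"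
  have yY: "y \<in> Y" and yD: "H x y \<in> D"
    and yopt: "ereal (g x y) \<le> value_fun Y D g H x 0 + ereal \<tau>"
    using y by (auto simp: tau_argmin_def value_fun_def)
  have \<delta>0: "0 \<le> \<delta>" and \<eta>0: "0 \<le> \<eta>" using g'[OF yY] H'[OF yY] by linarith+
  \<comment> \<open>Since \<open>H x y \<in> D\<close>, the distance of \<open>H' x y\<close> from
    \<open>D\<close> is at most \<open>\<eta>\<close>; the slack is scaled so that
    \<open>\<sigma> * N u\<close> exceeds \<open>\<sigma> * \<eta>\<close> by at most
    \<open>s\<close>.\<close>
  obtain u where u: "H' x y + u \<in> D" "N u < pdist N D (H' x y) + s / (\<sigma> + 1)"
    using pdist_approx[OF N D, of "s / (\<sigma> + 1)" "H' x y"] \<sigma> s by auto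
  have "pdist N D (H' x y) \<le> \<eta>" using H'[OF yY] pdist_eq_0[OF N yD] by linarith
  then have "\<sigma> * N u \<le> \<sigma> * (\<eta> + s / (\<sigma> + 1))" using u(2) \<sigma> by (intro mult_left_mono) auto
  also have "\<dots> \<le> \<sigma> * \<eta> + s" using \<sigma> s by (simp add: field_simps)
  finally have \<sigma>u: "\<sigma> * N u \<le> \<sigma> * \<eta> + s" .
  \<comment> \<open>The multiplier is taken as large as allowed. As distances are nonnegative, the
    penalty with weight \<open>lbar\<close> dominates the one with the calmness modulus
    \<open>lam\<close>, which is already exact.\<close>
  have "ereal (g' x y + \<alpha>) \<le> ereal (g' x z) + ereal lbar * set_dist N (H' x z) D + ereal \<tau>'"
    if "z \<in> Y'" for z
  proof -
    have zY: "z \<in> Y" using that Y' by auto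
    have "ereal (g x y) \<le> ereal (g x z + lam * pdist N D (H x z)) + ereal \<tau>"
      using yopt add_right_mono[OF calm_penalty[OF N D lam(1) calm zY]] by (rule order_trans)
    then have 1: "g x y \<le> g x z + lam * pdist N D (H x z) + \<tau>" by simp
    have 2: "lam * pdist N D (H x z) \<le> lbar * pdist N D (H x z)"
      using lam pdist_nonneg[OF N D] by (intro mult_right_mono)
    have "lbar * pdist N D (H x z) \<le> lbar * (pdist N D (H' x z) + \<eta>)"
      using lam H'[OF zY] by (intro mult_left_mono) auto
    then have 3: "lbar * pdist N D (H x z) \<le> lbar * pdist N D (H' x z) + lbar * \<eta>"
      by (simp add: algebra_simps)
    have "g' x y + \<alpha> \<le> g' x z + lbar * pdist N D (H' x z) + \<tau>'"
      using 1 2 3 g'[OF zY] g'[OF yY] unfolding \<alpha>_def by linarith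
    then show ?thesis by (simp add: set_dist_eq_pdist[OF N D])
  qed
  moreover have "\<alpha> \<le> 0"
    using \<delta>0 mult_nonneg_nonneg[of lbar \<eta>] \<eta>0 lam unfolding \<alpha>_def by linarith
  ultimately have "(x, y, u, \<alpha>, lbar) \<in> approx_feasible N X Y D Y' g' H' lbar \<tau>'"
    unfolding approx_feasible_def using x yY u(1) lam by auto
  then have "approx_min N X Y D Y' f' g' H' \<sigma> \<theta> lbar \<tau>'
      \<le> approx_objective N f' \<sigma> \<theta> (x, y, u, \<alpha>, lbar)"
    unfolding approx_min_def by (rule INF_lower)
  also have "\<dots> = f' x y + ereal (\<sigma> * N u - \<theta> * \<alpha>)" by (simp add: approx_objective_def)
  also have "\<dots> \<le> f' x y + ereal (\<sigma> * \<eta> + s + \<theta> * (2 * \<delta> + lbar * \<eta> + \<bar>\<tau>' - \<tau>\<bar>))"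
    using \<sigma>u unfolding \<alpha>_def by (intro add_left_mono) (simp add: algebra_simps)
  finally show ?thesis .
qed

text \<open>Feasibility compares \<open>y\<close> only with points of \<open>Y'\<close>. A
  comparison with \<open>w\<close> therefore passes through a surrogate \<open>z \<in> Y'\<close>
  whose penalized value exceeds \<open>g x w\<close> by at most \<open>e\<close>; the unknown
  \<open>lam\<close> is replaced by its bound \<open>lbar\<close>.\<close>

lemma approx_feasible_lower_level:
  assumes N: "is_norm N" and D: "D \<noteq> {}" and Y': "Y' \<subseteq> Y"
    and feas: "(x, y, u, \<alpha>, lam) \<in> approx_feasible N X Y D Y' g' H' lbar \<tau>'"
    and g': "\<And>z. z \<in> Y \<Longrightarrow> \<bar>g' x z - g x z\<bar> \<le> \<delta>"
    and H': "\<And>z. z \<in> Y \<Longrightarrow> \<bar>pdist N D (H' x z) - pdist N D (H x z)\<bar> \<le> \<eta>"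
    and z: "z \<in> Y'" "g x z + lbar * pdist N D (H x z) \<le> g x w + e"
  shows "g x y \<le> g x w + e + 2 * \<delta> + lbar * \<eta> + \<tau>' - \<alpha>"
proof -
  have zY: "z \<in> Y" using z Y' by auto
  have yY: "y \<in> Y" and lam: "lam \<le> lbar" "0 \<le> lam"
    and "ereal (g' x y + \<alpha>) \<le> ereal (g' x z) + ereal lam * set_dist N (H' x z) D + ereal \<tau>'"
    using feas z(1) by (auto simp: approx_feasible_def)
  then have 1: "g' x y + \<alpha> \<le> g' x z + lam * pdist N D (H' x z) + \<tau>'"
    by (simp add: set_dist_eq_pdist[OF N D])
  have 2: "lam * pdist N D (H' x z) \<le> lbar * pdist N D (H' x z)"
    using lam pdist_nonneg[OF N D] by (intro mult_right_mono)
  have "lbar * pdist N D (H' x z) \<le> lbar * (pdist N D (H x z) + \<eta>)"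
    using lam H'[OF zY] by (intro mult_left_mono) auto
  then have 3: "lbar * pdist N D (H' x z) \<le> lbar * pdist N D (H x z) + lbar * \<eta>"
    by (simp add: algebra_simps)
  show ?thesis using 1 2 3 g'[OF zY] g'[OF yY] z(2) by linarith
qed

section \<open>Limits along a set of indices and limits of weighted quantities\<close>

lemma along_le: "along S \<le> sequentially"
  unfolding along_def by simp

lemma along_neq_bot:
  assumes "infinite S"
  shows "along S \<noteq> bot"
proof
  assume "along S = bot"
  then have "eventually (\<lambda>_. False) (along S)" by simp
  then have "\<forall>\<^sub>F \<nu> in sequentially. \<nu> \<notin> S"
    by (simp add: along_def eventually_inf_principal)
  then obtain n where "\<forall>\<nu>\<ge>n. \<nu> \<notin> S" unfolding eventually_sequentially by blast
  then have "S \<subseteq> {..<n}" by (meson lessThan_iff not_le subsetI)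
  then show False using assms finite_subset by blast
qed

text \<open>Filling the indices outside \<open>S\<close> with the limit produces a full sequence,
  the form in which the lower limit condition on the objectives can be applied.\<close>

lemma tendsto_along_extend:
  assumes "(h \<longlongrightarrow> l) (along S)"
  shows "(\<lambda>\<nu>. if \<nu> \<in> S then h \<nu> else l) \<longlonglongrightarrow> l"
proof (rule topological_tendstoI)
  fix U
  assume U: "open U" "l \<in> U"
  have "\<forall>\<^sub>F \<nu> in sequentially. \<nu> \<in> S \<longrightarrow> h \<nu> \<in> U"
    using topological_tendstoD[OF assms U] by (simp add: along_def eventually_inf_principal)
  then show "\<forall>\<^sub>F \<nu> in sequentially. (if \<nu> \<in> S then h \<nu> else l) \<in> U"
    by eventually_elim (use U in auto)
qed

text \<open>Eventually \<open>w\<close> is positive, so \<open>v\<close> lies between 0 and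
  \<open>C / w\<close>, which tends to 0. Bounded penalties with diverging weights vanish in this
  way.\<close>

lemma tendsto_0_if_weighted_bounded:
  fixes w v :: "'i \<Rightarrow> real"
  assumes w: "filterlim w at_top F" and v: "\<And>i. 0 \<le> v i" and C: "\<forall>\<^sub>F i in F. w i * v i \<le> C"
  shows "(v \<longlongrightarrow> 0) F"
proof (rule tendsto_sandwich[of "\<lambda>_. 0" _ _ "\<lambda>i. C / w i"])
  have "\<forall>\<^sub>F i in F. 0 < w i" using w by (simp add: filterlim_at_top_dense)
  with C show "\<forall>\<^sub>F i in F. v i \<le> C / w i"
    by eventually_elim (simp add: field_simps)
  show "((\<lambda>i. C / w i) \<longlongrightarrow> 0) F"
    using tendsto_divide_0[OF tendsto_const filterlim_at_top_imp_at_infinity[OF w]] .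
qed (use v in auto)

lemma tendsto_0_if_weighted_tendsto_0:
  fixes w v :: "'i \<Rightarrow> real"
  assumes "filterlim w at_top F" "\<And>i. 0 \<le> v i" "((\<lambda>i. w i * v i) \<longlongrightarrow> 0) F"
  shows "(v \<longlongrightarrow> 0) F"
  using tendsto_0_if_weighted_bounded[OF assms(1,2), where C = 1] order_tendstoD(2)[OF assms(3), of 1]
  by (simp add: eventually_mono less_imp_le)

theorem theorem2p10:
  fixes N :: "real ^ 'q \<Rightarrow> real"
    and X :: "(real ^ 'n) set" and Y :: "(real ^ 'm) set" and D :: "(real ^ 'q) set"
    and Y\<nu> :: "nat \<Rightarrow> (real ^ 'm) set"
    and f :: "real ^ 'n \<Rightarrow> real ^ 'm \<Rightarrow> ereal" and f\<nu> :: "nat \<Rightarrow> real ^ 'n \<Rightarrow> real ^ 'm \<Rightarrow> ereal"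
    and g :: "real ^ 'n \<Rightarrow> real ^ 'm \<Rightarrow> real" and g\<nu> :: "nat \<Rightarrow> real ^ 'n \<Rightarrow> real ^ 'm \<Rightarrow> real"
    and H :: "real ^ 'n \<Rightarrow> real ^ 'm \<Rightarrow> real ^ 'q"
    and H\<nu> :: "nat \<Rightarrow> real ^ 'n \<Rightarrow> real ^ 'm \<Rightarrow> real ^ 'q"
    and \<tau> :: real and \<tau>\<nu> \<sigma>\<nu> \<theta>\<nu> lbar\<nu> \<delta>\<nu> \<eta>\<nu> \<epsilon>\<nu> :: "nat \<Rightarrow> real"
    and xstar :: "real ^ 'n" and ystar :: "real ^ 'm"
    and x\<nu> :: "nat \<Rightarrow> real ^ 'n" and y\<nu> :: "nat \<Rightarrow> real ^ 'm" and u\<nu> :: "nat \<Rightarrow> real ^ 'q"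
    and \<alpha>\<nu> lam\<nu> :: "nat \<Rightarrow> real"
    and S :: "nat set"
    and xhat :: "real ^ 'n" and yhat :: "real ^ 'm" and uhat :: "real ^ 'q" and \<alpha>hat :: real
  assumes norm_N: "is_norm N"
    and tau_nonneg: "0 \<le> \<tau>" "\<And>\<nu>. 0 \<le> \<tau>\<nu> \<nu>"
    and A1: "X \<noteq> {}" "closed X" "Y \<noteq> {}" "closed Y" "D \<noteq> {}" "closed D"
    and A2: "\<And>\<nu>. Y\<nu> \<nu> \<noteq> {}" "\<And>\<nu>. Y\<nu> \<nu> \<subseteq> Y" "pk_converges Y\<nu> Y"
    and A3: "\<delta>\<nu> \<longlonglongrightarrow> 0"
      "\<And>\<nu>. (SUP (x, y)\<in>X \<times> Y. ereal \<bar>g\<nu> \<nu> x y - g x y\<bar>) \<le> ereal (\<delta>\<nu> \<nu>)"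
      "continuous_on (X \<times> Y) (\<lambda>(x, y). g x y)"
    and A4: "\<eta>\<nu> \<longlonglongrightarrow> 0"
      "\<And>\<nu>. (SUP (x, y)\<in>X \<times> Y. \<bar>set_dist N (H\<nu> \<nu> x y) D - set_dist N (H x y) D\<bar>)
              \<le> ereal (\<eta>\<nu> \<nu>)"
      "continuous_on (X \<times> Y) (\<lambda>(x, y). H x y)"
    and f_proper: "\<And>x y. f x y > -\<infinity>" "\<And>\<nu> x y. f\<nu> \<nu> x y > -\<infinity>"
    and A5: "\<And>x y. x \<in> X \<Longrightarrow> y \<in> Y \<Longrightarrow> limsup (\<lambda>\<nu>. f\<nu> \<nu> x y) \<le> f x y"
      "\<And>x y xs ys. x \<in> X \<Longrightarrow> y \<in> Y \<Longrightarrow> (\<And>\<nu>. xs \<nu> \<in> X) \<Longrightarrow> xs \<longlonglongrightarrow> x \<Longrightarrow>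
         (\<And>\<nu>. ys \<nu> \<in> Y) \<Longrightarrow> ys \<longlonglongrightarrow> y \<Longrightarrow> liminf (\<lambda>\<nu>. f\<nu> \<nu> (xs \<nu>) (ys \<nu>)) \<ge> f x y"
    and A6: "\<And>\<nu>. 0 \<le> \<sigma>\<nu> \<nu>" "\<And>\<nu>. 0 \<le> \<theta>\<nu> \<nu>" "\<And>\<nu>. 0 \<le> lbar\<nu> \<nu>"
      "filterlim lbar\<nu> at_top sequentially"
      "(\<lambda>\<nu>. \<sigma>\<nu> \<nu> * \<eta>\<nu> \<nu>) \<longlonglongrightarrow> 0"
      "(\<lambda>\<nu>. \<theta>\<nu> \<nu> * lbar\<nu> \<nu> * \<eta>\<nu> \<nu>) \<longlonglongrightarrow> 0"
      "(\<lambda>\<nu>. \<theta>\<nu> \<nu> * \<delta>\<nu> \<nu>) \<longlonglongrightarrow> 0"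
    and sigma_theta: "filterlim \<sigma>\<nu> at_top sequentially" "filterlim \<theta>\<nu> at_top sequentially"
    and eps: "\<And>\<nu>. 0 \<le> \<epsilon>\<nu> \<nu>" "\<epsilon>\<nu> \<longlonglongrightarrow> 0"
    and tau_conv: "(\<lambda>\<nu>. \<theta>\<nu> \<nu> * \<bar>\<tau>\<nu> \<nu> - \<tau>\<bar>) \<longlonglongrightarrow> 0"
    and star: "P_optimal X Y D f g H \<tau> xstar ystar" "calm_at N (value_fun Y D g H) xstar"
    and eps_opt: "\<And>\<nu>. approx_eps_optimal N X Y D (Y\<nu> \<nu>) (f\<nu> \<nu>) (g\<nu> \<nu>) (H\<nu> \<nu>)
                     (\<sigma>\<nu> \<nu>) (\<theta>\<nu> \<nu>) (lbar\<nu> \<nu>) (\<tau>\<nu> \<nu>) (\<epsilon>\<nu> \<nu>) (x\<nu> \<nu>, y\<nu> \<nu>, u\<nu> \<nu>, \<alpha>\<nu> \<nu>, lam\<nu> \<nu>)"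
    and subseq: "infinite S"
      "((\<lambda>\<nu>. (x\<nu> \<nu>, y\<nu> \<nu>, u\<nu> \<nu>, \<alpha>\<nu> \<nu>)) \<longlongrightarrow> (xhat, yhat, uhat, \<alpha>hat)) (along S)"
    and hat_calm: "locally_calm_at N (value_fun Y D g H) xhat"
  shows
    "((\<forall>\<^sub>F \<nu> in sequentially. Y\<nu> \<nu> = Y) \<longrightarrow>
        P_optimal X Y D f g H \<tau> xhat yhat \<and>
        \<bar>P_min X Y D f g H \<tau>\<bar> \<noteq> \<infinity> \<and>
        ((\<lambda>\<nu>. approx_min N X Y D (Y\<nu> \<nu>) (f\<nu> \<nu>) (g\<nu> \<nu>) (H\<nu> \<nu>) (\<sigma>\<nu> \<nu>) (\<theta>\<nu> \<nu>) (lbar\<nu> \<nu>) (\<tau>\<nu> \<nu>))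
           \<longlongrightarrow> P_min X Y D f g H \<tau>) (along S))
     \<and>
     ((\<lambda>\<nu>. ereal (\<theta>\<nu> \<nu> * lbar\<nu> \<nu>) * (SUP y\<in>Y. set_dist norm y (Y\<nu> \<nu>))) \<longlonglongrightarrow> 0 \<and>
      (\<exists>\<kappa>g\<ge>0. \<exists>\<kappa>H\<ge>0. \<forall>x\<in>X. \<forall>y\<in>Y. \<forall>y'\<in>Y.
         \<bar>g x y - g x y'\<bar> \<le> \<kappa>g * norm (y - y') \<and> N (H x y - H x y') \<le> \<kappa>H * norm (y - y')) \<longrightarrow>
        P_optimal X Y D f g H \<tau> xhat yhat \<and>
        \<bar>P_min X Y D f g H \<tau>\<bar> \<noteq> \<infinity> \<and>
        ((\<lambda>\<nu>. approx_min N X Y D (Y\<nu> \<nu>) (f\<nu> \<nu>) (g\<nu> \<nu>) (H\<nu> \<nu>) (\<sigma>\<nu> \<nu>) (\<theta>\<nu> \<nu>) (lbar\<nu> \<nu>) (\<tau>\<nu> \<nu>))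
           \<longlongrightarrow> P_min X Y D f g H \<tau>) (along S))"
  proof -
  note N = norm_N and D = A1(5)
  let ?m = "P_min X Y D f g H \<tau>"
  let ?m\<nu> = "\<lambda>\<nu>. approx_min N X Y D (Y\<nu> \<nu>) (f\<nu> \<nu>) (g\<nu> \<nu>) (H\<nu> \<nu>) (\<sigma>\<nu> \<nu>) (\<theta>\<nu> \<nu>) (lbar\<nu> \<nu>) (\<tau>\<nu> \<nu>)"
  let ?F = "along S"

  \<comment> \<open>Pointwise error bounds for the lower-level data\<close>
  have gb: "\<bar>g\<nu> \<nu> x z - g x z\<bar> \<le> \<delta>\<nu> \<nu>" if "x \<in> X" "z \<in> Y" for \<nu> x z
  proof -
    have "(case (x, z) of (x, y) \<Rightarrow> ereal \<bar>g\<nu> \<nu> x y - g x y\<bar>)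
        \<le> (SUP (x, y)\<in>X \<times> Y. ereal \<bar>g\<nu> \<nu> x y - g x y\<bar>)"
      using that by (intro SUP_upper) auto
    from order_trans[OF this A3(2)[of \<nu>]] show ?thesis by simp
  qed
  have Hb: "\<bar>pdist N D (H\<nu> \<nu> x z) - pdist N D (H x z)\<bar> \<le> \<eta>\<nu> \<nu>" if "x \<in> X" "z \<in> Y" for \<nu> x z
  proof -
    have "(case (x, z) of (x, y) \<Rightarrow> \<bar>set_dist N (H\<nu> \<nu> x y) D - set_dist N (H x y) D\<bar>)
        \<le> (SUP (x, y)\<in>X \<times> Y. \<bar>set_dist N (H\<nu> \<nu> x y) D - set_dist N (H x y) D\<bar>)"
      using that by (intro SUP_upper) auto
    from order_trans[OF this A4(2)[of \<nu>]] show ?thesis by (simp add: set_dist_eq_pdist[OF N D])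
  qed
  have \<eta>_nonneg: "0 \<le> \<eta>\<nu> \<nu>" for \<nu>
    using A1(1,3) Hb by (metis abs_ge_zero all_not_in_conv order_trans)

  \<comment> \<open>Asymptotic upper bound on the minimum values\<close>
  obtain lam where lam: "0 \<le> lam"
    "\<And>u. value_fun Y D g H xstar u \<ge> value_fun Y D g H xstar 0 - ereal (lam * N u)"
    using star(2) unfolding calm_at_def by blast
  have xstar: "xstar \<in> X" and ystar: "ystar \<in> tau_argmin Y D g H \<tau> xstar"
    and fstar: "f xstar ystar < \<infinity>" "f xstar ystar \<le> ?m"
    using star(1) by (auto simp: P_optimal_def P_feasible_def)
  have ystar_Y: "ystar \<in> Y" using ystar by (simp add: tau_argmin_def)
  have m_le: "?m \<le> f x y" if "(x, y) \<in> P_feasible X Y D g H \<tau>" for x y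
    using INF_lower[OF that, of "\<lambda>(x, y). f x y"] by (simp add: P_min_def)
  have "?m \<le> f xstar ystar"
    using m_le xstar ystar by (simp add: P_feasible_def)
  then have m_eq: "f xstar ystar = ?m" using fstar(2) by (rule antisym[rotated])
  obtain m where m: "?m = ereal m"
    using fstar(1) f_proper(1)[of xstar ystar] m_eq by (cases ?m) auto

  \<comment> \<open>This is the excess in \<open>approx_min_le\<close> with the slack
    \<open>s\<close> chosen as \<open>inverse (real (Suc \<nu>))\<close>, which is positive and
    tends to 0.\<close>
  define r where "r = (\<lambda>\<nu>. \<sigma>\<nu> \<nu> * \<eta>\<nu> \<nu> + inverse (real (Suc \<nu>))
    + \<theta>\<nu> \<nu> * (2 * \<delta>\<nu> \<nu> + lbar\<nu> \<nu> * \<eta>\<nu> \<nu> + \<bar>\<tau>\<nu> \<nu> - \<tau>\<bar>))"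
  have "(\<lambda>\<nu>. \<sigma>\<nu> \<nu> * \<eta>\<nu> \<nu> + inverse (real (Suc \<nu>))
    + (2 * (\<theta>\<nu> \<nu> * \<delta>\<nu> \<nu>) + \<theta>\<nu> \<nu> * lbar\<nu> \<nu> * \<eta>\<nu> \<nu> + \<theta>\<nu> \<nu> * \<bar>\<tau>\<nu> \<nu> - \<tau>\<bar>)) \<longlonglongrightarrow> 0 + 0 + (2 * 0 + 0 + 0)"
    by (intro tendsto_intros A6 tau_conv LIMSEQ_inverse_real_of_nat)
  then have r: "r \<longlonglongrightarrow> 0"
    unfolding r_def by (simp add: algebra_simps)
  have m\<nu>_le: "\<forall>\<^sub>F \<nu> in sequentially. ?m\<nu> \<nu> \<le> f\<nu> \<nu> xstar ystar + ereal (r \<nu>)"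
  proof -
    have "\<forall>\<^sub>F \<nu> in sequentially. lam \<le> lbar\<nu> \<nu>" using A6(4) by (simp add: filterlim_at_top)
    then show ?thesis
    proof eventually_elim
      case (elim \<nu>)
      show ?case unfolding r_def
        by (rule approx_min_le[OF N D xstar ystar A2(2) lam(1) elim lam(2)])
          (use gb Hb xstar A6(1) in auto)
    qed
  qed
  \<comment> \<open>The gap \<open>c - m\<close> is shared equally between the objective value at
    \<open>(xstar, ystar)\<close> and the excess \<open>r\<close>.\<close>
  have upper: "\<forall>\<^sub>F \<nu> in sequentially. ?m\<nu> \<nu> < ereal c" if "m < c" for c
  proof -
    have "limsup (\<lambda>\<nu>. f\<nu> \<nu> xstar ystar) \<le> ereal m"
      using A5(1)[OF xstar ystar_Y] m_eq m by simp
    also have "\<dots> < ereal ((m + c) / 2)" using that by simp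
    finally have "\<forall>\<^sub>F \<nu> in sequentially. f\<nu> \<nu> xstar ystar < ereal ((m + c) / 2)"
      by (rule Limsup_lessD)
    moreover have "\<forall>\<^sub>F \<nu> in sequentially. r \<nu> < (c - m) / 2"
      using order_tendstoD(2)[OF r, of "(c - m) / 2"] that by simp
    ultimately show ?thesis using m\<nu>_le
    proof eventually_elim
      case (elim \<nu>)
      have "f\<nu> \<nu> xstar ystar + ereal (r \<nu>) < ereal c"
        using elim(1,2) by (cases "f\<nu> \<nu> xstar ystar") (auto simp: field_simps)
      with elim(3) show ?case by (rule le_less_trans)
    qed
  qed

  \<comment> \<open>The given near-minimizers and their limit\<close>
  have feas: "(x\<nu> \<nu>, y\<nu> \<nu>, u\<nu> \<nu>, \<alpha>\<nu> \<nu>, lam\<nu> \<nu>)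
      \<in> approx_feasible N X Y D (Y\<nu> \<nu>) (g\<nu> \<nu>) (H\<nu> \<nu>) (lbar\<nu> \<nu>) (\<tau>\<nu> \<nu>)" for \<nu>
    using eps_opt[of \<nu>] by (simp add: approx_eps_optimal_def)
  then have x\<nu>: "x\<nu> \<nu> \<in> X" and y\<nu>: "y\<nu> \<nu> \<in> Y" and \<alpha>\<nu>: "\<alpha>\<nu> \<nu> \<le> 0"
    and u\<nu>: "H\<nu> \<nu> (x\<nu> \<nu>) (y\<nu> \<nu>) + u\<nu> \<nu> \<in> D" for \<nu>
    by (auto simp: approx_feasible_def)
  have penalties_nonneg: "0 \<le> \<sigma>\<nu> \<nu> * N (u\<nu> \<nu>)" "0 \<le> \<theta>\<nu> \<nu> * (- \<alpha>\<nu> \<nu>)" for \<nu>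
    using A6(1,2) is_norm_nonneg[OF N] \<alpha>\<nu> by (simp_all add: mult_nonneg_nonpos)
  \<comment> \<open>An \<open>\<epsilon>\<close>-optimal point has a finite objective value, so its
    \<open>f\<nu>\<close> term is finite and the default value of \<open>real_of_ereal\<close> at
    infinity never enters.\<close>
  define fv where "fv \<nu> = real_of_ereal (f\<nu> \<nu> (x\<nu> \<nu>) (y\<nu> \<nu>))" for \<nu>
  have fv: "f\<nu> \<nu> (x\<nu> \<nu>) (y\<nu> \<nu>) = ereal (fv \<nu>)" for \<nu>
    using eps_opt[of \<nu>] unfolding fv_def
    by (cases "f\<nu> \<nu> (x\<nu> \<nu>) (y\<nu> \<nu>)") (auto simp: approx_eps_optimal_def approx_objective_def)
  have obj: "ereal (fv \<nu> + \<sigma>\<nu> \<nu> * N (u\<nu> \<nu>) + \<theta>\<nu> \<nu> * (- \<alpha>\<nu> \<nu>)) \<le> ?m\<nu> \<nu> + ereal (\<epsilon>\<nu> \<nu>)" for \<nu>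
    using eps_opt[of \<nu>] by (simp add: approx_eps_optimal_def approx_objective_def fv algebra_simps)

  have nb: "?F \<noteq> bot" using along_neq_bot[OF subseq(1)] .
  have xlim: "(x\<nu> \<longlongrightarrow> xhat) ?F" and ylim: "(y\<nu> \<longlongrightarrow> yhat) ?F"
    using tendsto_fst[OF subseq(2)] tendsto_fst[OF tendsto_snd[OF subseq(2)]] by simp_all
  have xhat: "xhat \<in> X" using Lim_in_closed_set[OF A1(2) _ nb xlim] x\<nu> by simp
  have yhat: "yhat \<in> Y" using Lim_in_closed_set[OF A1(4) _ nb ylim] y\<nu> by simp
  have f_lower: "\<forall>\<^sub>F \<nu> in ?F. c < fv \<nu>" if "ereal c < f xhat yhat" for c
  proof -
    \<comment> \<open>Constant continuation by the limit keeps both sequences in \<open>X\<close>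
      and \<open>Y\<close> and convergent; only indices in \<open>S\<close> are read off
      afterwards.\<close>
    let ?xs = "\<lambda>\<nu>. if \<nu> \<in> S then x\<nu> \<nu> else xhat" and ?ys = "\<lambda>\<nu>. if \<nu> \<in> S then y\<nu> \<nu> else yhat"
    have "f xhat yhat \<le> liminf (\<lambda>\<nu>. f\<nu> \<nu> (?xs \<nu>) (?ys \<nu>))"
      using x\<nu> y\<nu> xhat yhat
      by (intro A5(2) tendsto_along_extend xlim ylim) auto
    with that have "\<forall>\<^sub>F \<nu> in sequentially. ereal c < f\<nu> \<nu> (?xs \<nu>) (?ys \<nu>)"
      by (intro less_LiminfD) (rule less_le_trans)
    then have "\<forall>\<^sub>F \<nu> in sequentially. \<nu> \<in> S \<longrightarrow> c < fv \<nu>"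
      by eventually_elim (auto simp: fv)
    then show ?thesis by (simp add: along_def eventually_inf_principal)
  qed
  have seq_along: "eventually P ?F" if "eventually P sequentially" for P
    using along_le that by (rule filter_leD)

  \<comment> \<open>Vanishing penalties and error terms\<close>
  obtain c where c: "ereal c < f xhat yhat"
    using ereal_dense2[OF f_proper(1)[of xhat yhat]] by blast
  have "\<forall>\<^sub>F \<nu> in ?F. \<sigma>\<nu> \<nu> * N (u\<nu> \<nu>) + \<theta>\<nu> \<nu> * (- \<alpha>\<nu> \<nu>) \<le> m + 2 - c"
    \<comment> \<open>The constant collects the upper bound \<open>m + 1\<close> for the minimum
      values, the bound 1 for the tolerances and the lower bound \<open>c\<close> for the objective
      terms \<open>fv\<close>.\<close>
    using f_lower[OF c] seq_along[OF upper[of "m + 1", simplified]]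
      seq_along[OF order_tendstoD(2)[OF eps(2) zero_less_one]]
  proof eventually_elim
    case (elim \<nu>)
    show ?case using obj[of \<nu>] elim by (cases "?m\<nu> \<nu>") auto
  qed
  then have bnd: "\<forall>\<^sub>F \<nu> in ?F. \<sigma>\<nu> \<nu> * N (u\<nu> \<nu>) \<le> m + 2 - c \<and> \<theta>\<nu> \<nu> * (- \<alpha>\<nu> \<nu>) \<le> m + 2 - c"
  proof eventually_elim
    case (elim \<nu>)
    then show ?case using penalties_nonneg[of \<nu>] by linarith
  qed
  have N_u: "((\<lambda>\<nu>. N (u\<nu> \<nu>)) \<longlongrightarrow> 0) ?F"
    by (rule tendsto_0_if_weighted_bounded[OF filterlim_mono[OF sigma_theta(1) order_refl along_le]
          is_norm_nonneg[OF N] eventually_mono[OF bnd conjunct1]])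
  have "((\<lambda>\<nu>. - \<alpha>\<nu> \<nu>) \<longlongrightarrow> 0) ?F"
    by (rule tendsto_0_if_weighted_bounded[OF filterlim_mono[OF sigma_theta(2) order_refl along_le] _
          eventually_mono[OF bnd conjunct2]])
      (use \<alpha>\<nu> in simp)
  then have \<alpha>_0: "(\<alpha>\<nu> \<longlongrightarrow> 0) ?F" using tendsto_minus_cancel_left[of \<alpha>\<nu> 0] by simp
  \<comment> \<open>As \<open>\<theta>\<nu>\<close> diverges, the weighted limit assumption forces
    the unweighted product to vanish as well.\<close>
  have lbar_\<eta>: "(\<lambda>\<nu>. lbar\<nu> \<nu> * \<eta>\<nu> \<nu>) \<longlonglongrightarrow> 0"
    by (rule tendsto_0_if_weighted_tendsto_0[OF sigma_theta(2)])
      (use A6(3,6) \<eta>_nonneg in \<open>auto simp: mult.assoc\<close>)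
  have "(\<lambda>\<nu>. \<bar>\<tau>\<nu> \<nu> - \<tau>\<bar>) \<longlonglongrightarrow> 0"
    by (rule tendsto_0_if_weighted_tendsto_0[OF sigma_theta(2) _ tau_conv]) simp
  then have \<tau>_lim: "\<tau>\<nu> \<longlonglongrightarrow> \<tau>"
    by (rule LIM_zero_cancel[OF tendsto_rabs_zero_cancel])
  have g_lim: "((\<lambda>\<nu>. g (a \<nu>) (b \<nu>)) \<longlongrightarrow> g a' b') ?F"
    and d_lim: "((\<lambda>\<nu>. pdist N D (H (a \<nu>) (b \<nu>))) \<longlongrightarrow> pdist N D (H a' b')) ?F"
    if "(a \<longlongrightarrow> a') ?F" "(b \<longlongrightarrow> b') ?F" "\<And>\<nu>. a \<nu> \<in> X" "\<And>\<nu>. b \<nu> \<in> Y" "a' \<in> X" "b' \<in> Y" for a b a' b'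
  proof -
    have *: "((\<lambda>\<nu>. (a \<nu>, b \<nu>)) \<longlongrightarrow> (a', b')) ?F" "\<forall>\<^sub>F \<nu> in ?F. (a \<nu>, b \<nu>) \<in> X \<times> Y"
      using that by (auto intro: tendsto_Pair)
    show "((\<lambda>\<nu>. g (a \<nu>) (b \<nu>)) \<longlongrightarrow> g a' b') ?F"
      using continuous_on_tendsto_compose[OF A3(3) *(1) _ *(2)] that by simp
    have "((\<lambda>\<nu>. H (a \<nu>) (b \<nu>)) \<longlongrightarrow> H a' b') ?F"
      using continuous_on_tendsto_compose[OF A4(3) *(1) _ *(2)] that by simp
    then show "((\<lambda>\<nu>. pdist N D (H (a \<nu>) (b \<nu>))) \<longlongrightarrow> pdist N D (H a' b')) ?F"
      using continuous_on_tendsto_compose[OF pdist_continuous[OF N D]] by simp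
  qed

  \<comment> \<open>Feasibility of the limit for the constraint set\<close>
  have "pdist N D (H xhat yhat) \<le> 0 + 0"
  \<comment> \<open>The displacement \<open>u\<nu>\<close> bounds the distance for
    \<open>H\<nu>\<close>, and passing to \<open>H\<close> costs at most
    \<open>\<eta>\<nu>\<close>.\<close>
  proof (rule tendsto_le[OF nb _ d_lim[OF xlim ylim x\<nu> y\<nu> xhat yhat]])
    show "((\<lambda>\<nu>. N (u\<nu> \<nu>) + \<eta>\<nu> \<nu>) \<longlongrightarrow> 0 + 0) ?F"
      by (intro tendsto_add N_u tendsto_mono[OF along_le A4(1)])
    show "\<forall>\<^sub>F \<nu> in ?F. pdist N D (H (x\<nu> \<nu>) (y\<nu> \<nu>)) \<le> N (u\<nu> \<nu>) + \<eta>\<nu> \<nu>"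
    proof (rule always_eventually, rule allI)
      fix \<nu>
      show "pdist N D (H (x\<nu> \<nu>) (y\<nu> \<nu>)) \<le> N (u\<nu> \<nu>) + \<eta>\<nu> \<nu>"
        using pdist_le[OF N u\<nu>[of \<nu>], of "H\<nu> \<nu> (x\<nu> \<nu>) (y\<nu> \<nu>)"]
          Hb[OF x\<nu>[of \<nu>] y\<nu>[of \<nu>], of \<nu>] is_norm_minus[OF N, of "u\<nu> \<nu>"]
        by simp
    qed
  qed
  then have Hhat: "H xhat yhat \<in> D"
    using pdist_eq_0_imp_mem[OF N D A1(6)] pdist_nonneg[OF N D, of "H xhat yhat"] by simp

  \<comment> \<open>Optimality of the limit, given surrogates in the approximating sets\<close>
  obtain lamh \<rho> where lamh: "0 \<le> lamh" and \<rho>: "0 < \<rho>"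
    and calm: "\<And>u x. norm (x - xhat) \<le> \<rho> \<Longrightarrow>
      value_fun Y D g H x u \<ge> value_fun Y D g H x 0 - ereal (lamh * N u)"
    using hat_calm unfolding locally_calm_at_def by blast
  have near: "\<forall>\<^sub>F \<nu> in ?F. norm (x\<nu> \<nu> - xhat) \<le> \<rho>"
    using tendstoD[OF xlim \<rho>] by eventually_elim (simp add: dist_norm)

  \<comment> \<open>Cases (a) and (b) differ only in how \<open>approx\<close> is obtained. The
    error \<open>e\<close> must be uniform in \<open>x\<close>, because the condition is applied at
    the moving points \<open>x\<nu> \<nu>\<close>.\<close>
  have conclusion: "P_optimal X Y D f g H \<tau> xhat yhat \<and> \<bar>?m\<bar> \<noteq> \<infinity> \<and> (?m\<nu> \<longlongrightarrow> ?m) ?F"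
    if e: "e \<longlonglongrightarrow> 0" and approx: "\<forall>\<^sub>F \<nu> in sequentially. \<forall>x\<in>X. \<forall>w\<in>Y. H x w \<in> D \<longrightarrow>
        (\<exists>z\<in>Y\<nu> \<nu>. g x z + lbar\<nu> \<nu> * pdist N D (H x z) \<le> g x w + e \<nu>)" for e
  proof -
    have "g xhat yhat \<le> g xhat z + \<tau>" if z: "z \<in> Y" "H xhat z \<in> D" for z
    proof -
      let ?Q = "\<lambda>\<nu>. e \<nu> + 2 * \<delta>\<nu> \<nu> + lbar\<nu> \<nu> * \<eta>\<nu> \<nu> + \<tau>\<nu> \<nu> - \<alpha>\<nu> \<nu>"
      have "\<forall>\<^sub>F \<nu> in ?F. g (x\<nu> \<nu>) (y\<nu> \<nu>)
          \<le> g (x\<nu> \<nu>) z + lamh * pdist N D (H (x\<nu> \<nu>) z) + ?Q \<nu>"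
        using near seq_along[OF approx]
      proof eventually_elim
        case (elim \<nu>)
        let ?b = "g (x\<nu> \<nu>) z + lamh * pdist N D (H (x\<nu> \<nu>) z)"
        show ?case
        proof (rule field_le_epsilon)
          fix s :: real
          assume "0 < s"
          \<comment> \<open>The point \<open>z\<close> is feasible at \<open>xhat\<close> but
            perhaps not at \<open>x\<nu> \<nu>\<close>. Local calmness still bounds the value at
            \<open>x\<nu> \<nu>\<close> by the penalized value of \<open>z\<close>, so some feasible
            \<open>w\<close> nearly attains it, and \<open>approx\<close> replaces \<open>w\<close>
            by a point of \<open>Y\<nu> \<nu>\<close>.\<close>
          then have "value_fun Y D g H (x\<nu> \<nu>) 0 < ereal (?b + s)"
            by (intro le_less_trans[OF calm_penalty[OF N D lamh calm[OF elim(1)] z(1)]]) simp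
          then obtain w where w: "w \<in> Y" "H (x\<nu> \<nu>) w \<in> D" "g (x\<nu> \<nu>) w < ?b + s"
            unfolding value_fun_def INF_less_iff by auto
          obtain z' where z': "z' \<in> Y\<nu> \<nu>"
            "g (x\<nu> \<nu>) z' + lbar\<nu> \<nu> * pdist N D (H (x\<nu> \<nu>) z') \<le> g (x\<nu> \<nu>) w + e \<nu>"
            using elim(2) x\<nu> w by blast
          have "g (x\<nu> \<nu>) (y\<nu> \<nu>)
              \<le> g (x\<nu> \<nu>) w + e \<nu> + 2 * \<delta>\<nu> \<nu> + lbar\<nu> \<nu> * \<eta>\<nu> \<nu> + \<tau>\<nu> \<nu> - \<alpha>\<nu> \<nu>"
            by (rule approx_feasible_lower_level[where g = g and H = H, OF N D A2(2) feas _ _ z'])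
              (use gb Hb x\<nu> in auto)
          then show "g (x\<nu> \<nu>) (y\<nu> \<nu>) \<le> ?b + ?Q \<nu> + s" using w(3) by linarith
        qed
      qed
      \<comment> \<open>The weight \<open>lamh\<close> does not grow with the index, unlike
        \<open>lbar\<nu>\<close>, so the penalty at \<open>z\<close> converges, and its limit is 0
        because \<open>H xhat z \<in> D\<close>.\<close>
      moreover have "((\<lambda>\<nu>. g (x\<nu> \<nu>) z + lamh * pdist N D (H (x\<nu> \<nu>) z) + ?Q \<nu>)
          \<longlongrightarrow> g xhat z + lamh * pdist N D (H xhat z) + (0 + 2 * 0 + 0 + \<tau> - 0)) ?F"
        using e A3(1) lbar_\<eta> \<tau>_lim x\<nu> xhat z xlim
        by (intro tendsto_intros \<alpha>_0 g_lim d_lim) (auto intro: tendsto_mono[OF along_le])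
      ultimately have "g xhat yhat \<le> g xhat z + lamh * pdist N D (H xhat z) + (0 + 2 * 0 + 0 + \<tau> - 0)"
        using tendsto_le[OF nb _ g_lim[OF xlim ylim x\<nu> y\<nu> xhat yhat]] by blast
      then show ?thesis using pdist_eq_0[OF N z(2)] by simp
    qed
    then have "ereal (g xhat yhat - \<tau>) \<le> (INF z\<in>{z \<in> Y. H xhat z \<in> D}. ereal (g xhat z))"
      by (intro INF_greatest) (auto simp: algebra_simps)
    then have "ereal (g xhat yhat) \<le> (INF z\<in>{z \<in> Y. H xhat z \<in> D}. ereal (g xhat z)) + ereal \<tau>"
      using add_right_mono[of "ereal (g xhat yhat - \<tau>)" _ "ereal \<tau>"] by fastforce
    then have hat_feas: "(xhat, yhat) \<in> P_feasible X Y D g H \<tau>"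
      using xhat yhat Hhat by (simp add: P_feasible_def tau_argmin_def)
    have lower: "\<forall>\<^sub>F \<nu> in ?F. ereal b < ?m\<nu> \<nu>" if b: "ereal b < f xhat yhat" for b
    proof -
      obtain b' where b': "ereal b < ereal b'" "ereal b' < f xhat yhat"
        using ereal_dense2[OF b] by blast
      have "\<forall>\<^sub>F \<nu> in ?F. \<epsilon>\<nu> \<nu> < b' - b"
        using seq_along[OF order_tendstoD(2)[OF eps(2), of "b' - b"]] b'(1) by simp
      with f_lower[OF b'(2)] show ?thesis
      proof eventually_elim
        case (elim \<nu>)
        show ?case using obj[of \<nu>] elim penalties_nonneg[of \<nu>] by (cases "?m\<nu> \<nu>") auto
      qed
    qed
    \<comment> \<open>Otherwise a level \<open>b\<close> strictly in between would eventually lie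
      both below and above the minimum values along \<open>S\<close>.\<close>
    have "f xhat yhat \<le> ereal m"
    proof (rule ccontr)
      assume "\<not> f xhat yhat \<le> ereal m"
      then obtain b where b: "ereal m < ereal b" "ereal b < f xhat yhat"
        using ereal_dense2[of "ereal m" "f xhat yhat"] by (auto simp: not_le)
      have "\<forall>\<^sub>F \<nu> in ?F. False"
        using lower[OF b(2)] seq_along[OF upper[of b]] b(1) by (auto elim: eventually_elim2)
      then show False using nb by simp
    qed
    then have f_hat: "f xhat yhat = ereal m" using m_le[OF hat_feas] m by simp
    have "(?m\<nu> \<longlongrightarrow> ereal m) ?F"
    proof (rule order_tendstoI)
      fix a
      assume "a < ereal m"
      then obtain b where b: "a < ereal b" "ereal b < ereal m" using ereal_dense2 by blast
      show "\<forall>\<^sub>F \<nu> in ?F. a < ?m\<nu> \<nu>"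
        using lower[of b] b f_hat by (auto elim: eventually_mono)
    next
      fix a
      assume "ereal m < a"
      then obtain b where b: "ereal m < ereal b" "ereal b < a" using ereal_dense2 by blast
      show "\<forall>\<^sub>F \<nu> in ?F. ?m\<nu> \<nu> < a"
        using seq_along[OF upper[of b]] b by (auto elim: eventually_mono)
    qed
    then show ?thesis using hat_feas f_hat m by (simp add: P_optimal_def)
  qed

  \<comment> \<open>Construction of the surrogates in cases (a) and (b)\<close>
  show ?thesis
  proof (rule conjI; rule impI)
    assume "\<forall>\<^sub>F \<nu> in sequentially. Y\<nu> \<nu> = Y"
    then have "\<forall>\<^sub>F \<nu> in sequentially. \<forall>x\<in>X. \<forall>w\<in>Y. H x w \<in> D \<longrightarrow>
        (\<exists>z\<in>Y\<nu> \<nu>. g x z + lbar\<nu> \<nu> * pdist N D (H x z) \<le> g x w + 0)"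
    proof eventually_elim
      case (elim \<nu>)
      show ?case
      proof (intro ballI impI)
        fix x w
        assume "w \<in> Y" "H x w \<in> D"
        \<comment> \<open>Here \<open>w\<close> is its own surrogate, its penalty being 0.\<close>
        then show "\<exists>z\<in>Y\<nu> \<nu>. g x z + lbar\<nu> \<nu> * pdist N D (H x z) \<le> g x w + 0"
          using elim by (intro bexI[of _ w]) (simp_all add: pdist_eq_0[OF N])
      qed
    qed
    then show "P_optimal X Y D f g H \<tau> xhat yhat \<and> \<bar>?m\<bar> \<noteq> \<infinity> \<and> (?m\<nu> \<longlongrightarrow> ?m) ?F"
      using conclusion[of "\<lambda>_. 0"] by simp
  next
    assume "(\<lambda>\<nu>. ereal (\<theta>\<nu> \<nu> * lbar\<nu> \<nu>) * (SUP y\<in>Y. set_dist norm y (Y\<nu> \<nu>))) \<longlonglongrightarrow> 0 \<and>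
      (\<exists>\<kappa>g\<ge>0. \<exists>\<kappa>H\<ge>0. \<forall>x\<in>X. \<forall>y\<in>Y. \<forall>y'\<in>Y.
         \<bar>g x y - g x y'\<bar> \<le> \<kappa>g * norm (y - y') \<and> N (H x y - H x y') \<le> \<kappa>H * norm (y - y'))"
    then obtain \<kappa>g \<kappa>H where excess: "(\<lambda>\<nu>. ereal (\<theta>\<nu> \<nu> * lbar\<nu> \<nu>) * (SUP y\<in>Y. set_dist norm y (Y\<nu> \<nu>))) \<longlonglongrightarrow> 0"
      and \<kappa>: "0 \<le> \<kappa>g" "0 \<le> \<kappa>H"
      and lip_g: "\<And>x y y'. x \<in> X \<Longrightarrow> y \<in> Y \<Longrightarrow> y' \<in> Y \<Longrightarrow> \<bar>g x y - g x y'\<bar> \<le> \<kappa>g * norm (y - y')"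
      and lip_H: "\<And>x y y'. x \<in> X \<Longrightarrow> y \<in> Y \<Longrightarrow> y' \<in> Y \<Longrightarrow> N (H x y - H x y') \<le> \<kappa>H * norm (y - y')"
      by blast
    have norm: "is_norm (norm :: real ^ 'm \<Rightarrow> real)" by (simp add: is_norm_def norm_triangle_ineq)
    define s where "s \<nu> = (SUP y\<in>Y. set_dist norm y (Y\<nu> \<nu>))" for \<nu>
    have s_ge: "ereal (pdist norm (Y\<nu> \<nu>) w) \<le> s \<nu>" if "w \<in> Y" for w \<nu>
      unfolding s_def set_dist_eq_pdist[OF norm A2(1), symmetric] using that by (rule SUP_upper)
    have s_nonneg: "0 \<le> s \<nu>" for \<nu>
      using s_ge[OF ystar_Y, of \<nu>] pdist_nonneg[OF norm A2(1)[of \<nu>], of ystar]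
      by (metis ereal_less_eq(5) order_trans)
    define rs where "rs \<nu> = real_of_ereal (s \<nu>)" for \<nu>
    have rs_nonneg: "0 \<le> rs \<nu>" for \<nu>
      unfolding rs_def using s_nonneg by (rule real_of_ereal_pos)
    have "\<forall>\<^sub>F \<nu> in sequentially. 1 \<le> \<theta>\<nu> \<nu>" and lbar1: "\<forall>\<^sub>F \<nu> in sequentially. 1 \<le> lbar\<nu> \<nu>"
      using sigma_theta(2) A6(4) by (auto simp: filterlim_at_top)
    moreover have "\<forall>\<^sub>F \<nu> in sequentially. ereal (\<theta>\<nu> \<nu> * lbar\<nu> \<nu>) * s \<nu> < 1"
      using order_tendstoD(2)[OF excess, of 1] by (simp add: s_def)
    \<comment> \<open>The supremum could be infinite for some indices. Once the weight is positive,
      which excludes \<open>0 * \<infinity> = 0\<close>, a product below 1 makes it finite and equal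
      to \<open>rs\<close>.\<close>
    ultimately have s_fin: "\<forall>\<^sub>F \<nu> in sequentially. s \<nu> = ereal (rs \<nu>)"
    proof eventually_elim
      case (elim \<nu>)
      have "0 < \<theta>\<nu> \<nu> * lbar\<nu> \<nu>" using elim by (intro mult_pos_pos) auto
      then show ?case using elim(3) s_nonneg[of \<nu>] unfolding rs_def
        by (cases "s \<nu>") (auto split: if_splits)
    qed
    have "(\<lambda>\<nu>. ereal (\<theta>\<nu> \<nu> * (lbar\<nu> \<nu> * rs \<nu>))) \<longlonglongrightarrow> ereal 0"
    proof (rule Lim_transform_eventually)
      show "(\<lambda>\<nu>. ereal (\<theta>\<nu> \<nu> * lbar\<nu> \<nu>) * s \<nu>) \<longlonglongrightarrow> ereal 0"
        using excess by (simp add: s_def zero_ereal_def)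
      show "\<forall>\<^sub>F \<nu> in sequentially. ereal (\<theta>\<nu> \<nu> * lbar\<nu> \<nu>) * s \<nu> = ereal (\<theta>\<nu> \<nu> * (lbar\<nu> \<nu> * rs \<nu>))"
        using s_fin by eventually_elim (simp add: mult.assoc)
    qed
    then have "(\<lambda>\<nu>. \<theta>\<nu> \<nu> * (lbar\<nu> \<nu> * rs \<nu>)) \<longlonglongrightarrow> 0" by (simp only: lim_ereal)
    then have lbar_rs: "(\<lambda>\<nu>. lbar\<nu> \<nu> * rs \<nu>) \<longlonglongrightarrow> 0"
      by (rule tendsto_0_if_weighted_tendsto_0[OF sigma_theta(2), rotated])
        (use A6(3) rs_nonneg in simp)
    \<comment> \<open>The second factor will bound \<open>lbar\<nu>\<close> times the length of a
      near-projection onto \<open>Y\<nu>\<close>. The \<open>\<kappa>g\<close> term also gets the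
      weight \<open>lbar\<nu>\<close>, at least 1 eventually, so that one limit serves both
      Lipschitz constants.\<close>
    define e where "e = (\<lambda>\<nu>. (\<kappa>g + \<kappa>H) * (lbar\<nu> \<nu> * rs \<nu> + inverse (real (Suc \<nu>))))"
    have "e \<longlonglongrightarrow> (\<kappa>g + \<kappa>H) * (0 + 0)"
      unfolding e_def by (intro tendsto_intros lbar_rs LIMSEQ_inverse_real_of_nat)
    then have "e \<longlonglongrightarrow> 0" by simp
    moreover have "\<forall>\<^sub>F \<nu> in sequentially. \<forall>x\<in>X. \<forall>w\<in>Y. H x w \<in> D \<longrightarrow>
        (\<exists>z\<in>Y\<nu> \<nu>. g x z + lbar\<nu> \<nu> * pdist N D (H x z) \<le> g x w + e \<nu>)"
      using lbar1 s_fin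
    proof eventually_elim
      case (elim \<nu>)
      show ?case
      proof (intro ballI impI)
        fix x w
        assume xw: "x \<in> X" "w \<in> Y" "H x w \<in> D"
        \<comment> \<open>Division by \<open>lbar\<nu> \<nu>\<close> makes the slack
          \<open>inverse (real (Suc \<nu>))\<close> after multiplication by the penalty
          weight.\<close>
        let ?t = "inverse (real (Suc \<nu>)) / lbar\<nu> \<nu>"
        obtain v where v: "w + v \<in> Y\<nu> \<nu>" "norm v < pdist norm (Y\<nu> \<nu>) w + ?t"
          using pdist_approx[OF norm A2(1)[of \<nu>], of ?t w] elim(1) by auto
        have vY: "w + v \<in> Y" using v(1) A2(2) by auto
        have "norm v \<le> rs \<nu> + ?t" using v(2) s_ge[OF xw(2), of \<nu>] elim(2) by simp
        then have "lbar\<nu> \<nu> * norm v \<le> lbar\<nu> \<nu> * (rs \<nu> + ?t)" using elim(1) by (intro mult_left_mono) auto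
        also have "\<dots> = lbar\<nu> \<nu> * rs \<nu> + inverse (real (Suc \<nu>))"
          using elim(1) by (simp add: distrib_left)
        finally have lv: "lbar\<nu> \<nu> * norm v \<le> lbar\<nu> \<nu> * rs \<nu> + inverse (real (Suc \<nu>))" .
        have "g x (w + v) \<le> g x w + \<kappa>g * norm v"
          using lip_g[OF xw(1) vY xw(2)] by simp
        also have "\<dots> \<le> g x w + \<kappa>g * (lbar\<nu> \<nu> * norm v)"
          using elim(1) \<kappa>(1) mult_right_mono[of 1 "lbar\<nu> \<nu>" "norm v"] by (simp add: mult_left_mono)
        finally have 1: "g x (w + v) \<le> g x w + \<kappa>g * (lbar\<nu> \<nu> * norm v)" .
        \<comment> \<open>The distance is 0 at \<open>w\<close>, so its value at
          \<open>w + v\<close> is at most the variation of \<open>H\<close> between the two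
          points.\<close>
        have "pdist N D (H x (w + v)) \<le> \<kappa>H * norm v"
          using pdist_triangle[OF N D, of "H x (w + v)" "H x w"] pdist_eq_0[OF N xw(3)]
            lip_H[OF xw(1) vY xw(2)] by simp
        then have "lbar\<nu> \<nu> * pdist N D (H x (w + v)) \<le> lbar\<nu> \<nu> * (\<kappa>H * norm v)"
          using elim(1) by (intro mult_left_mono) auto
        with 1 have "g x (w + v) + lbar\<nu> \<nu> * pdist N D (H x (w + v))
            \<le> g x w + (\<kappa>g + \<kappa>H) * (lbar\<nu> \<nu> * norm v)"
          by (simp add: algebra_simps)
        also have "\<dots> \<le> g x w + e \<nu>"
          unfolding e_def using \<kappa> lv by (intro add_left_mono mult_left_mono) auto
        finally show "\<exists>z\<in>Y\<nu> \<nu>. g x z + lbar\<nu> \<nu> * pdist N D (H x z) \<le> g x w + e \<nu>"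
          using v(1) by blast
      qed
    qed
    ultimately show "P_optimal X Y D f g H \<tau> xhat yhat \<and> \<bar>?m\<bar> \<noteq> \<infinity> \<and> (?m\<nu> \<longlongrightarrow> ?m) ?F"
      by (rule conclusion)
  qed
qed

end
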